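(* Let $F_n$ denote the Fibonacci numbers extended to all integers $n$ by $F_n=\dfrac{\phi^n-(1-\phi)^n}{\sqrt5}$, where $\phi=\frac{1+\sqrt5}{2}$ (so $F_{-1}=1$, $F_0=0$, $F_1=F_2=1$, and $F_{n+1}=F_n+F_{n-1}$ for all $n$). Then for every number $x$ for which the denominator below is nonzero, $$e=\dfrac{\displaystyle\sum_{k=0}^\infty\frac{F_{k+1}+xF_{k-1}}{k!}}{\displaystyle\sum_{k=0}^\infty(-1)^{k}\,\frac{F_{k-1}+xF_{k+1}}{k!}}.$$
   Context: $F_n$ is defined for all integers $n$ (including $n=-1$) by the Binet formula $F_n=(\phi^n-(1-\phi)^n)/\sqrt5$ with $\phi=(1+\sqrt5)/2$. *)

theory Defs
  imports Complex_Main
begin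

definition golden :: real
  where "golden = (1 + sqrt 5) / 2"

definition Fib :: "int \<Rightarrow> real"
  where "Fib n = (golden powi n - (1 - golden) powi n) / sqrt 5"

lemma golden_sq: "golden ^ 2 = golden + 1"
  by (simp add: golden_def power2_eq_square field_simps)

lemma conj_golden_sq: "(1 - golden) ^ 2 = (1 - golden) + 1"
  using golden_sq by (simp add: power2_eq_square algebra_simps)

lemma golden_nonzero: "golden \<noteq> 0" "1 - golden \<noteq> 0"
  using golden_sq conj_golden_sq by (force simp: power2_eq_square)+

lemma Fib_0: "Fib 0 = 0"
  by (simp add: Fib_def)

lemma Fib_1: "Fib 1 = 1"
  by (simp add: Fib_def golden_def field_simps)

lemma Fib_rec: "Fib (n + 1) = Fib n + Fib (n - 1)"
proof -
  have *: "a powi (n + 1) = a powi n + a powi (n - 1)"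
    if "a \<noteq> 0" "a ^ 2 = a + 1" for a :: real
  proof -
    have "a powi (n + 1) = a powi (n - 1) * a ^ 2"
      using that(1) power_int_add[of a "n - 1" 2] by (simp add: add.commute)
    moreover have "a powi n = a powi (n - 1) * a"
      using that(1) power_int_add[of a "n - 1" 1] by simp
    ultimately show ?thesis
      using that(2) by (simp add: algebra_simps)
  qed
  show ?thesis
    unfolding Fib_def
    using *[OF golden_nonzero(1) golden_sq] *[OF golden_nonzero(2) conj_golden_sq]
    by (simp add: add_divide_distrib diff_divide_distrib)
qed

lemma Fib_minus_1: "Fib (-1) = 1"
  using Fib_rec[of 0] by (simp add: Fib_0 Fib_1)

lemma Fib_2: "Fib 2 = 1"
  using Fib_rec[of 1] by (simp add: Fib_0 Fib_1)

end

theory Submission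
  imports Defs
begin

text \<open>
  Write \<open>a = golden\<close> and \<open>b = 1 - golden\<close>, so that \<open>a + b = 1\<close> and \<open>a * b = -1\<close>. Both exponential
  generating functions are combinations of \<open>exp (t * a)\<close> and \<open>exp (t * b)\<close>, and since
  \<open>exp 1 * exp (- a) = exp b\<close> and vice versa, multiplying the value at \<open>t = -1\<close> of one of them by
  \<open>exp 1\<close> gives the value at \<open>t = 1\<close> of the other.
\<close>

lemma Fib_int_plus_1:
  "Fib (int k + 1) = (golden * golden ^ k - (1 - golden) * (1 - golden) ^ k) / sqrt 5"
  using golden_nonzero by (simp add: Fib_def power_int_add mult.commute)

text \<open>Since \<open>golden * (1 - golden) = -1\<close>, dividing by one root amounts to
  multiplying by minus the other. Hence the coefficients are those of \<open>Fib_int_plus_1\<close>,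
  with the two powers exchanged.\<close>

lemma Fib_int_minus_1:
  "Fib (int k - 1) = (golden * (1 - golden) ^ k - (1 - golden) * golden ^ k) / sqrt 5"
proof -
  have "inverse golden = - (1 - golden)" "inverse (1 - golden) = - golden"
    using golden_sq
    by (auto intro!: inverse_unique simp del: minus_diff_eq simp: power2_eq_square algebra_simps)
  then show ?thesis
    using golden_nonzero
    by (simp add: Fib_def power_int_diff divide_inverse mult.commute) (simp add: algebra_simps)
qed

text \<open>The factor \<open>t ^ k\<close> stays outside so that \<open>t = 1\<close> serves the
  numerator and \<open>t = -1\<close> yields the alternating signs of the denominator.\<close>

lemma sums_exp_combination:
  fixes a b c d r t :: real
  shows "(\<lambda>k. t ^ k * ((c * a ^ k - d * b ^ k) / r / fact k)) sums
    ((c * exp (t * a) - d * exp (t * b)) / r)"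
proof -
  have "(\<lambda>k. (c * ((t * a) ^ k /\<^sub>R fact k) - d * ((t * b) ^ k /\<^sub>R fact k)) / r) sums
    ((c * exp (t * a) - d * exp (t * b)) / r)"
    by (intro sums_divide sums_diff sums_mult exp_converges)
  then show ?thesis
    by (simp add: power_mult_distrib divide_inverse algebra_simps)
qed

lemma sums_Fib_plus_1:
  "(\<lambda>k. t ^ k * (Fib (int k + 1) / fact k)) sums
    ((golden * exp (t * golden) - (1 - golden) * exp (t * (1 - golden))) / sqrt 5)"
  using sums_exp_combination[of t golden golden "1 - golden" "1 - golden" "sqrt 5"] by (simp add: Fib_int_plus_1)

lemma sums_Fib_minus_1:
  "(\<lambda>k. t ^ k * (Fib (int k - 1) / fact k)) sums
    ((golden * exp (t * (1 - golden)) - (1 - golden) * exp (t * golden)) / sqrt 5)"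
  using sums_exp_combination[of t golden "1 - golden" "1 - golden" golden "sqrt 5"]
  by (simp add: Fib_int_minus_1)

text \<open>The Fibonacci series are real while \<open>x\<close> is complex; real convergence
  carries over through \<open>of_real\<close>, and the rest is linearity.\<close>

lemma sums_complex_combination:
  fixes x :: complex and t :: real
  assumes "(\<lambda>k. t ^ k * (f k / fact k)) sums u" "(\<lambda>k. t ^ k * (g k / fact k)) sums v"
  shows "(\<lambda>k. of_real t ^ k * ((of_real (f k) + x * of_real (g k)) / fact k)) sums
    (of_real u + x * of_real v)"
proof -
  have "(\<lambda>k. of_real (t ^ k * (f k / fact k)) + x * of_real (t ^ k * (g k / fact k))) sums
    (of_real u + x * of_real v)"
    using assms by (intro sums_add sums_mult) (simp_all only: sums_of_real_iff)
  then show ?thesis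
    by (simp add: field_simps)
qed

theorem theorem1:
  fixes x :: complex
  assumes "(\<Sum>k. (-1) ^ k *
      ((of_real (Fib (int k - 1)) + x * of_real (Fib (int k + 1))) / fact k)) \<noteq> 0"
  shows "summable (\<lambda>k. (of_real (Fib (int k + 1)) + x * of_real (Fib (int k - 1))) / fact k) \<and>
    summable (\<lambda>k. (-1) ^ k *
      ((of_real (Fib (int k - 1)) + x * of_real (Fib (int k + 1))) / fact k)) \<and>
    exp 1 =
      (\<Sum>k. (of_real (Fib (int k + 1)) + x * of_real (Fib (int k - 1))) / fact k) /
      (\<Sum>k. (-1) ^ k *
        ((of_real (Fib (int k - 1)) + x * of_real (Fib (int k + 1))) / fact k))"
proof -
  \<comment> \<open>\<open>P\<close> and \<open>M\<close> are the exponential generating functions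
    of \<open>Fib (k + 1)\<close> and \<open>Fib (k - 1)\<close>.\<close>
  define P where "P t = (golden * exp (t * golden) - (1 - golden) * exp (t * (1 - golden))) / sqrt 5"
    for t :: real
  define M where "M t = (golden * exp (t * (1 - golden)) - (1 - golden) * exp (t * golden)) / sqrt 5"
    for t :: real
  have num: "(\<lambda>k. (of_real (Fib (int k + 1)) + x * of_real (Fib (int k - 1))) / fact k) sums
      (of_real (P 1) + x * of_real (M 1))"
    using sums_complex_combination[OF sums_Fib_plus_1[of 1] sums_Fib_minus_1[of 1], of x]
    by (simp add: P_def M_def)
  have den: "(\<lambda>k. (-1) ^ k *
        ((of_real (Fib (int k - 1)) + x * of_real (Fib (int k + 1))) / fact k)) sums
      (of_real (M (-1)) + x * of_real (P (-1)))"
    using sums_complex_combination[OF sums_Fib_minus_1[of "-1"] sums_Fib_plus_1[of "-1"], of x]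
    by (simp add: P_def M_def)
  have "exp (1 - golden) = exp 1 * exp (- golden)" "exp golden = exp 1 * exp (golden - 1)"
    by (simp_all flip: exp_add)
  then have "P 1 = exp 1 * M (-1)" "M 1 = exp 1 * P (-1)"
    by (simp_all only: P_def M_def mult_1 mult_minus1 minus_diff_eq) (simp_all add: algebra_simps)
  \<comment> \<open>Here \<open>exp 1\<close> is complex, so the real factor \<open>exp 1\<close>
    from the previous step is moved out of \<open>of_real\<close>.\<close>
  then have "of_real (P 1) + x * of_real (M 1) =
      exp 1 * (of_real (M (-1)) + x * of_real (P (-1)))"
    by (simp add: algebra_simps flip: exp_of_real)
  then show ?thesis
    using assms num den by (simp add: sums_iff)
qed

end
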